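(* Let $\{\varphi_j\}$ be the tensor-product B-Spline basis on $\Omega$, and let $u$ be a scalar control variable. Let $$\tilde u(\mathbf{x})=\sum_j\tilde u_j\varphi_j(\mathbf{x})$$ be the B-Spline expansion of the control variable of the predictor solution, with real weights $\tilde u_j$. Suppose the flux limiter is applied to these weights, producing flux-corrected weights $u_j^{n+1}$; that is, the $u_j^{n+1}$ satisfy the limiter's guarantee $$\tilde u_i^{\min}\le u_i^{n+1}\le\tilde u_i^{\max}\quad\text{for all } i,$$ where $\tilde u_i^{\min}:=\min_{j\neq i}\tilde u_j$ and $\tilde u_i^{\max}:=\max_{j\ne i}\tilde u_j$ are the local minima and maxima of the predictor weights (with $j$ ranging over the neighbors of $i$). Then the flux-corrected end-of-step solution $$u^{n+1}(\mathbf{x})=\sum_j u_j^{n+1}\varphi_j(\mathbf{x})$$ remains bounded from below and above by the bounding functions $\tilde u^{\min}(\mathbf{x})=\sum_j\tilde u_j^{\min}\varphi_j(\mathbf{x})$ and $\tilde u^{\max}(\mathbf{x})=\sum_j\tilde u_j^{\max}\varphi_j(\mathbf{x})$, i.e. $$\tilde u^{\min}(\mathbf{x})\le u^{n+1}(\mathbf{x})\le\tilde u^{\max}(\mathbf{x})\quad\text{for all }\mathbf{x}\in\Omega.$$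
   Context: Let $d\ge1$. For each coordinate direction $l=1,\dots,d$ fix a polynomial degree $p_l\ge1$ and an open knot vector on $[0,1]$ (end knots $0,1$ of multiplicity exactly $p_l+1$, interior knots of multiplicity at most $p_l$). The univariate B-Splines are those defined by the Cox-de Boor recursion, extended to the right endpoint by continuity. The tensor-product B-Splines $\hat\varphi_j:\hat\Omega=[0,1]^d\to\mathbb{R}$ are all products of $d$ univariate B-Splines, one per direction, enumerated by a single finite index $j$. The domain is $\Omega=\phi(\hat\Omega)\subset\mathbb{R}^d$, where the geometry mapping $\phi(\boldsymbol\xi)=\sum_j\mathbf{x}_j\hat\varphi_j(\boldsymbol\xi)$, with control points $\mathbf{x}_j\in\mathbb{R}^d$, is assumed to be a bijection $\hat\Omega\to\Omega$. The basis functions on $\Omega$ are $\varphi_j=\hat\varphi_j\circ\phi^{-1}$. The consistent mass matrix has entries $m_{ij}=\int_\Omega\varphi_i\varphi_j\,\mathrm{d}\mathbf{x}$. The neighbors of $i$ are the indices $j\neq i$ with $m_{ij}\ne0$. The flux limiter is that of the linearized FCT (flux-corrected transport) scheme: it adds limited antidiffusive corrections to the coefficients of a positivity-preserving predictor so that the coefficients $u_i^{n+1}$ of each control variable (e.g. density or pressure) after correction lie between the local minimum and local maximum of the predictor coefficients $\tilde u_j$. This coefficient-wise bound is the property of the limiter used in the statement. The superscript $n+1$ denotes the new time level. *)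

theory Defs
  imports "HOL-Analysis.Analysis"
begin

definition open_knot_vector :: "nat \<Rightarrow> real list \<Rightarrow> bool" where
  "open_knot_vector p U \<longleftrightarrow>
     sorted U \<and> set U \<subseteq> {0..1} \<and>
     count_list U 0 = p + 1 \<and> count_list U 1 = p + 1 \<and>
     (\<forall>t\<in>{0<..<1}. count_list U t \<le> p)"

(* Knots and basis functions are indexed from 0. The usual convention 0/0 = 0 for coincident
   knots is the library convention for division by 0. *)
fun cox_de_boor :: "real list \<Rightarrow> nat \<Rightarrow> nat \<Rightarrow> real \<Rightarrow> real" where
  "cox_de_boor U 0 i t = (if U ! i \<le> t \<and> t < U ! (i + 1) then 1 else 0)"
| "cox_de_boor U (Suc p) i t =
     (t - U ! i) / (U ! (i + p + 1) - U ! i) * cox_de_boor U p i t +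
     (U ! (i + p + 2) - t) / (U ! (i + p + 2) - U ! (i + 1)) * cox_de_boor U p (i + 1) t"

(* With half-open knot spans the recursion yields 0 at the right endpoint 1; the value
   there is instead the limit from the left. *)
definition bspline :: "real list \<Rightarrow> nat \<Rightarrow> nat \<Rightarrow> real \<Rightarrow> real" where
  "bspline U p i t =
     (if t = 1 then Lim (at_left 1) (cox_de_boor U p i) else cox_de_boor U p i t)"

definition unit_cube :: "(real ^ 'd) set" where
  "unit_cube = {\<xi>. \<forall>l. \<xi> $ l \<in> {0..1}}"

(* Tensor-product functions are indexed directly by multi-indices. A knot vector with m entries
   carries m - p - 1 B-Splines of degree p. *)
definition tp_index :: "('d::finite \<Rightarrow> nat) \<Rightarrow> ('d \<Rightarrow> real list) \<Rightarrow> ('d \<Rightarrow> nat) set" where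
  "tp_index p U = {j. \<forall>l. j l < length (U l) - p l - 1}"

definition tp_bspline ::
  "('d::finite \<Rightarrow> nat) \<Rightarrow> ('d \<Rightarrow> real list) \<Rightarrow> ('d \<Rightarrow> nat) \<Rightarrow> real ^ 'd \<Rightarrow> real" where
  "tp_bspline p U j \<xi> = (\<Prod>l\<in>UNIV. bspline (U l) (p l) (j l) (\<xi> $ l))"

definition geometry_map ::
  "('d::finite \<Rightarrow> nat) \<Rightarrow> ('d \<Rightarrow> real list) \<Rightarrow> (('d \<Rightarrow> nat) \<Rightarrow> real ^ 'd) \<Rightarrow>
   real ^ 'd \<Rightarrow> real ^ 'd" where
  "geometry_map p U X \<xi> = (\<Sum>j\<in>tp_index p U. tp_bspline p U j \<xi> *\<^sub>R X j)"

definition phys_domain ::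
  "('d::finite \<Rightarrow> nat) \<Rightarrow> ('d \<Rightarrow> real list) \<Rightarrow> (('d \<Rightarrow> nat) \<Rightarrow> real ^ 'd) \<Rightarrow> (real ^ 'd) set" where
  "phys_domain p U X = geometry_map p U X ` unit_cube"

definition phys_basis ::
  "('d::finite \<Rightarrow> nat) \<Rightarrow> ('d \<Rightarrow> real list) \<Rightarrow> (('d \<Rightarrow> nat) \<Rightarrow> real ^ 'd) \<Rightarrow>
   ('d \<Rightarrow> nat) \<Rightarrow> real ^ 'd \<Rightarrow> real" where
  "phys_basis p U X j x = tp_bspline p U j (inv_into unit_cube (geometry_map p U X) x)"

definition mass_matrix ::
  "('d::finite \<Rightarrow> nat) \<Rightarrow> ('d \<Rightarrow> real list) \<Rightarrow> (('d \<Rightarrow> nat) \<Rightarrow> real ^ 'd) \<Rightarrow>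
   ('d \<Rightarrow> nat) \<Rightarrow> ('d \<Rightarrow> nat) \<Rightarrow> real" where
  "mass_matrix p U X i j =
     (LINT x:phys_domain p U X|lborel. phys_basis p U X i x * phys_basis p U X j x)"

definition neighbors ::
  "('d::finite \<Rightarrow> nat) \<Rightarrow> ('d \<Rightarrow> real list) \<Rightarrow> (('d \<Rightarrow> nat) \<Rightarrow> real ^ 'd) \<Rightarrow>
   ('d \<Rightarrow> nat) \<Rightarrow> ('d \<Rightarrow> nat) set" where
  "neighbors p U X i = {j \<in> tp_index p U. j \<noteq> i \<and> mass_matrix p U X i j \<noteq> 0}"

(* For p l >= 1, open knot vectors and injective geometry_map, the sets of neighbors below
   are nonempty, so the values of Min and Max are meaningful. *)
definition local_min ::
  "('d::finite \<Rightarrow> nat) \<Rightarrow> ('d \<Rightarrow> real list) \<Rightarrow> (('d \<Rightarrow> nat) \<Rightarrow> real ^ 'd) \<Rightarrow>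
   (('d \<Rightarrow> nat) \<Rightarrow> real) \<Rightarrow> ('d \<Rightarrow> nat) \<Rightarrow> real" where
  "local_min p U X u i = Min (u ` neighbors p U X i)"

definition local_max ::
  "('d::finite \<Rightarrow> nat) \<Rightarrow> ('d \<Rightarrow> real list) \<Rightarrow> (('d \<Rightarrow> nat) \<Rightarrow> real ^ 'd) \<Rightarrow>
   (('d \<Rightarrow> nat) \<Rightarrow> real) \<Rightarrow> ('d \<Rightarrow> nat) \<Rightarrow> real" where
  "local_max p U X u i = Max (u ` neighbors p U X i)"

definition expansion ::
  "('d::finite \<Rightarrow> nat) \<Rightarrow> ('d \<Rightarrow> real list) \<Rightarrow> (('d \<Rightarrow> nat) \<Rightarrow> real ^ 'd) \<Rightarrow>
   (('d \<Rightarrow> nat) \<Rightarrow> real) \<Rightarrow> real ^ 'd \<Rightarrow> real" where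
  "expansion p U X u x = (\<Sum>j\<in>tp_index p U. u j * phys_basis p U X j x)"

end

theory Submission
  imports Defs
begin

text \<open>The difference of two expansions is the sum of coefficient differences times basis
  functions, so all rests on the sign of one univariate B-Spline. The recursion's linear weights can
  be negative, but only where the lower-degree spline they multiply vanishes
  (\<open>cox_de_boor_eq_0\<close>), which yields \<open>cox_de_boor_nonneg\<close> by induction.
  The right endpoint carries a left limit, whose existence is
  \<open>cox_de_boor_left_limit\<close>.\<close>

text \<open>B-Splines are nonnegative, so an expansion is monotone in its coefficients, and the
  coefficient-wise bounds of the limiter carry over to the functions.\<close>

lemma cox_de_boor_eq_0:
  assumes "sorted U" and "i + p + 1 < length U" and "t < U ! i \<or> U ! (i + p + 1) \<le> t"
  shows "cox_de_boor U p i t = 0"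
  using assms(2,3)
proof (induction p arbitrary: i)
  case 0
  then show ?case by auto
next
  case (Suc p)
  have "U ! i \<le> U ! (i + 1)" "U ! (i + p + 1) \<le> U ! (i + p + 2)"
    using \<open>sorted U\<close> Suc.prems(1) by (auto intro!: sorted_nth_mono)
  then have "cox_de_boor U p i t = 0" "cox_de_boor U p (i + 1) t = 0"
    using Suc.prems by (auto intro!: Suc.IH)
  then show ?case by simp
qed

lemma cox_de_boor_nonneg:
  assumes "sorted U" and "i + p + 1 < length U"
  shows "0 \<le> cox_de_boor U p i t"
  using assms(2)
proof (induction p arbitrary: i)
  case 0
  then show ?case by simp
next
  case (Suc p)
  have "U ! i \<le> U ! (i + p + 1)" "U ! (i + 1) \<le> U ! (i + p + 2)"
    using \<open>sorted U\<close> Suc.prems by (auto intro!: sorted_nth_mono)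
  moreover have "0 \<le> cox_de_boor U p i t" "0 \<le> cox_de_boor U p (i + 1) t"
    using Suc.prems by (auto intro!: Suc.IH)
  \<comment> \<open>Where the lower-degree spline is nonzero, t lies in its support, so the
    numerator of its weight is nonnegative; elsewhere the product is 0. Coincident knots give weight
    0.\<close>
  moreover have "U ! i \<le> t" if "cox_de_boor U p i t \<noteq> 0"
    using cox_de_boor_eq_0[OF \<open>sorted U\<close>, of i p t] that Suc.prems by force
  moreover have "t \<le> U ! (i + p + 2)" if "cox_de_boor U p (i + 1) t \<noteq> 0"
    using cox_de_boor_eq_0[OF \<open>sorted U\<close>, of "i + 1" p t] that Suc.prems by force
  ultimately have
    "0 \<le> (t - U ! i) / (U ! (i + p + 1) - U ! i) * cox_de_boor U p i t"
    "0 \<le> (U ! (i + p + 2) - t) / (U ! (i + p + 2) - U ! (i + 1)) * cox_de_boor U p (i + 1) t"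
    by (metis diff_ge_0_iff_ge divide_nonneg_nonneg mult_nonneg_nonneg mult_zero_right order_refl)+
  then show ?case
    by simp
qed

text \<open>\<open>Lim\<close> denotes a meaningful value only if a limit exists, so
  \<open>bspline\<close> at 1 depends on this.\<close>

lemma cox_de_boor_left_limit: "\<exists>c. (cox_de_boor U p i \<longlongrightarrow> c) (at_left (a :: real))"
proof (induction p arbitrary: i)
  case 0
  \<comment> \<open>Close enough to a on its left, t no longer crosses b, so degree-0 splines are
    eventually constant there.\<close>
  have *: "(\<forall>\<^sub>F t in at_left a. t < b) \<or> (\<forall>\<^sub>F t in at_left a. b \<le> t)" for b :: real
  proof (cases "b < a")
    case True
    then show ?thesis
      by (auto simp: eventually_at_left_field)
  next
    case False
    then show ?thesis
      by (auto simp: eventually_at_left_field intro!: exI[of _ "a - 1"])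
  qed
  consider "\<forall>\<^sub>F t in at_left a. t < U ! i" | "\<forall>\<^sub>F t in at_left a. U ! (i + 1) \<le> t"
    | "\<forall>\<^sub>F t in at_left a. U ! i \<le> t \<and> t < U ! (i + 1)"
    using *[of "U ! i"] *[of "U ! (i + 1)"] eventually_conj by blast
  then have "(\<forall>\<^sub>F t in at_left a. cox_de_boor U 0 i t = 0) \<or> (\<forall>\<^sub>F t in at_left a. cox_de_boor U 0 i t = 1)"
  proof cases
    case 1
    then show ?thesis by (intro disjI1) (auto elim!: eventually_mono)
  next
    case 2
    then show ?thesis by (intro disjI1) (auto elim!: eventually_mono)
  next
    case 3
    then show ?thesis by (intro disjI2) (auto elim!: eventually_mono)
  qed
  then show ?case
    by (auto intro: tendsto_eventually)
next
  case (Suc p)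
  obtain c d where "(cox_de_boor U p i \<longlongrightarrow> c) (at_left a)" "(cox_de_boor U p (i + 1) \<longlongrightarrow> d) (at_left a)"
    using Suc.IH by blast
  then show ?case
    \<comment> \<open>Written with \<open>inverse\<close>, division by a knot difference becomes
      multiplication by a constant, so the limit rules apply even when the difference is 0.\<close>
    unfolding cox_de_boor.simps(2)[abs_def] divide_inverse by (intro exI) (assumption | rule tendsto_intros)+
qed

lemma bspline_nonneg:
  assumes "sorted U" and "i + p + 1 < length U"
  shows "0 \<le> bspline U p i t"
proof -
  obtain c where c: "(cox_de_boor U p i \<longlongrightarrow> c) (at_left 1)"
    using cox_de_boor_left_limit by blast
  then have "0 \<le> c"
    by (rule tendsto_lowerbound) (auto simp: cox_de_boor_nonneg[OF assms])
  moreover have "Lim (at_left 1) (cox_de_boor U p i) = c"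
    using c by (intro tendsto_Lim) simp_all
  ultimately show ?thesis
    by (simp add: bspline_def cox_de_boor_nonneg[OF assms])
qed

lemma phys_basis_nonneg:
  assumes "\<And>l. sorted (U l)" and "j \<in> tp_index p U"
  shows "0 \<le> phys_basis p U X j x"
  unfolding phys_basis_def tp_bspline_def
proof (intro prod_nonneg bspline_nonneg assms(1) ballI)
  \<comment> \<open>The strict bound in \<open>tp_index\<close> forces the truncated subtraction to
    be positive, so it can be rearranged.\<close>
  show "j l + p l + 1 < length (U l)" for l
    using assms(2) by (auto simp: tp_index_def dest: spec[of _ l])
qed

lemma expansion_mono:
  assumes "\<And>l. sorted (U l)" and "\<And>j. j \<in> tp_index p U \<Longrightarrow> u j \<le> v j"
  shows "expansion p U X u x \<le> expansion p U X v x"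
  unfolding expansion_def by (intro sum_mono mult_right_mono assms phys_basis_nonneg)

theorem theorem2:
  fixes p :: "'d::finite \<Rightarrow> nat"
    and U :: "'d \<Rightarrow> real list"
    and X :: "('d \<Rightarrow> nat) \<Rightarrow> real ^ 'd"
    and u_pred u_new :: "('d \<Rightarrow> nat) \<Rightarrow> real"
  assumes degree: "\<And>l. p l \<ge> 1"
    and knots: "\<And>l. open_knot_vector (p l) (U l)"
    and bijective: "bij_betw (geometry_map p U X) unit_cube (phys_domain p U X)"
    and limiter: "\<And>i. i \<in> tp_index p U \<Longrightarrow>
      local_min p U X u_pred i \<le> u_new i \<and> u_new i \<le> local_max p U X u_pred i"
  shows "\<forall>x\<in>phys_domain p U X.
      expansion p U X (local_min p U X u_pred) x \<le> expansion p U X u_new x \<and>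
      expansion p U X u_new x \<le> expansion p U X (local_max p U X u_pred) x"
proof -
  have "\<And>l. sorted (U l)"
    using knots by (simp add: open_knot_vector_def)
  then show ?thesis
    \<comment> \<open>The limiter's two inequalities are the coefficient comparisons for the lower
      and the upper bound.\<close>
    using limiter by (auto intro!: expansion_mono)
qed

end
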